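(* Let $\mathcal{A}\subseteq\mathcal{B}(\mathcal{H}_1)$ and $\mathcal{B}\subseteq\mathcal{B}(\mathcal{H}_2)$ be reflexive algebras, $\mathcal{L}_1=\operatorname{Lat}\mathcal{A}$ and $\mathcal{L}_2=\operatorname{Lat}\mathcal{B}$. For $\varphi\in\mathcal{M}(\mathcal{L}_1,\mathcal{L}_2)$ and $\psi\in\mathcal{M}(\mathcal{L}_2,\mathcal{L}_1)$ put $$\mathcal{U}_\varphi=\{T\in\mathcal{B}(\mathcal{H}_1,\mathcal{H}_2):TL=\varphi(L)T\ \forall L\in\mathcal{L}_1\},\qquad \mathcal{V}_\psi=\{S\in\mathcal{B}(\mathcal{H}_2,\mathcal{H}_1):SM=\psi(M)S\ \forall M\in\mathcal{L}_2\}.$$ Then the set $N(\mathcal{B},\mathcal{A})$ of normalizers of $\mathcal{B}$ into $\mathcal{A}$ is a union of reflexive normalizing subspaces. More precisely, $$N(\mathcal{B},\mathcal{A})=\bigcup\{\mathcal{U}_\varphi\cap\mathcal{V}_\psi^*:\varphi\in\mathcal{M}(\mathcal{L}_1,\mathcal{L}_2),\ \psi\in\mathcal{M}(\mathcal{L}_2,\mathcal{L}_1)\},$$ where each $\mathcal{U}_\varphi\cap\mathcal{V}_\psi^*$ is a reflexive normalizing subspace.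
   Context: All Hilbert spaces are complex and separable. $\mathcal{P}_i$ is the lattice of all projections on $\mathcal{H}_i$, $P^\perp=I-P$. Reflexive algebras are unital: $\mathcal{A}$ is reflexive if $\mathcal{A}=\operatorname{Alg}\operatorname{Lat}\mathcal{A}$, where $\operatorname{Lat}\mathcal{A}=\{L:L^\perp AL=0\ \forall A\in\mathcal{A}\}$ and $\operatorname{Alg}\mathcal{L}=\{A:L^\perp AL=0\ \forall L\in\mathcal{L}\}$. $N(\mathcal{B},\mathcal{A})=\{T\in\mathcal{B}(\mathcal{H}_1,\mathcal{H}_2):T^*\mathcal{B}T\subseteq\mathcal{A}\text{ and }T\mathcal{A}T^*\subseteq\mathcal{B}\}$. For $\{i,j\}=\{1,2\}$, $\mathcal{M}(\mathcal{P}_i,\mathcal{P}_j)$ is the set of maps $\varphi:\mathcal{P}_i\to\mathcal{P}_j$ with $\varphi(0)=0$ preserving arbitrary suprema; put $\mathcal{S}_{2\varphi}=\varphi(\mathcal{P}_i)$ and $\mathcal{S}_{1\varphi}=\{\bigvee\{P\in\mathcal{P}_i:\varphi(P)\le Q\}:Q\in\mathcal{P}_j\}$; $\mathcal{M}(\mathcal{L}_i,\mathcal{L}_j)=\{\varphi\in\mathcal{M}(\mathcal{P}_i,\mathcal{P}_j):\mathcal{S}_{1\varphi}\subseteq\mathcal{L}_i,\ \mathcal{S}_{2\varphi}\subseteq\mathcal{L}_j\}$. $\mathcal{V}_\psi^*=\{S^*:S\in\mathcal{V}_\psi\}$. A linear subspace $\mathcal{U}\subseteq\mathcal{B}(\mathcal{H}_1,\mathcal{H}_2)$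 is normalizing if $AB^*C\in\mathcal{U}$ for all $A,B,C\in\mathcal{U}$; it is reflexive if every $T$ with $Tx\in\overline{\mathcal{U}x}$ for all $x\in\mathcal{H}_1$ belongs to $\mathcal{U}$. *)

theory Defs
  imports "HOL-Analysis.Analysis"
begin

section \<open>Separable complex Hilbert spaces\<close>

text \<open>HOL-Analysis only has real inner product spaces.  A complex inner product space is taken to be
  a space of class \<open>real_inner\<close> carrying in addition a complex scalar multiplication that extends
  the real one, and a Hermitian form, linear in the first argument, whose real part is the given real
  inner product.  Positive definiteness of the form and \<open>norm x ^ 2 = \<langle>x, x\<rangle>\<close> are inherited from
  \<open>real_inner\<close>, since \<open>\<langle>x, x\<rangle>\<close> is real by Hermitian symmetry.\<close>

class complex_inner = real_inner +
  fixes scaleC :: "complex \<Rightarrow> 'a \<Rightarrow> 'a" (infixr "*\<^sub>C" 75)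
    and cinner :: "'a \<Rightarrow> 'a \<Rightarrow> complex"
  assumes scaleC_add_right: "a *\<^sub>C (x + y) = a *\<^sub>C x + a *\<^sub>C y"
    and scaleC_add_left: "(a + b) *\<^sub>C x = a *\<^sub>C x + b *\<^sub>C x"
    and scaleC_scaleC: "a *\<^sub>C b *\<^sub>C x = (a * b) *\<^sub>C x"
    and scaleC_of_real: "complex_of_real r *\<^sub>C x = r *\<^sub>R x"
    and cinner_commute: "cinner x y = cnj (cinner y x)"
    and cinner_add_left: "cinner (x + y) z = cinner x z + cinner y z"
    and cinner_scaleC_left: "cinner (a *\<^sub>C x) y = a * cinner x y"
    and Re_cinner: "Re (cinner x y) = inner x y"

class separable_hilbert = complex_inner + complete_space +
  assumes separable: "\<exists>D. countable D \<and> (\<forall>x. \<forall>e>0. \<exists>d\<in>D. dist d x < e)"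


section \<open>Bounded operators, adjoints and projections\<close>

definition bounded_ops :: "('a::complex_inner \<Rightarrow> 'b::complex_inner) set"
  where "bounded_ops = {T. bounded_linear T \<and> (\<forall>c x. T (c *\<^sub>C x) = c *\<^sub>C T x)}"

text \<open>For \<open>T\<close> in \<open>bounded_ops\<close> on a Hilbert space the adjoint exists and is unique
  (Riesz representation).\<close>

definition cadjoint :: "('a::separable_hilbert \<Rightarrow> 'b::separable_hilbert) \<Rightarrow> 'b \<Rightarrow> 'a"
  where "cadjoint T = (THE S. S \<in> bounded_ops \<and> (\<forall>x y. cinner (T x) y = cinner x (S y)))"

definition projections :: "('a::separable_hilbert \<Rightarrow> 'a) set"
  where "projections = {P \<in> bounded_ops. P \<circ> P = P \<and> cadjoint P = P}"

definition proj_compl :: "('a::separable_hilbert \<Rightarrow> 'a) \<Rightarrow> 'a \<Rightarrow> 'a"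
  where "proj_compl P = (\<lambda>x. x - P x)"

definition proj_le :: "('a::separable_hilbert \<Rightarrow> 'a) \<Rightarrow> ('a \<Rightarrow> 'a) \<Rightarrow> bool"
  where "proj_le P Q \<longleftrightarrow> range P \<subseteq> range Q"

text \<open>The projections form a complete lattice, so the least upper bound below exists (and is unique)
  for every set \<open>F\<close> of projections; it is the projection onto the closed linear span of the ranges.\<close>

definition proj_Sup :: "('a::separable_hilbert \<Rightarrow> 'a) set \<Rightarrow> 'a \<Rightarrow> 'a"
  where "proj_Sup F = (THE S. S \<in> projections \<and> (\<forall>P\<in>F. proj_le P S) \<and>
           (\<forall>Q\<in>projections. (\<forall>P\<in>F. proj_le P Q) \<longrightarrow> proj_le S Q))"


section \<open>Reflexive algebras and normalizers\<close>

definition Lat :: "('a::separable_hilbert \<Rightarrow> 'a) set \<Rightarrow> ('a \<Rightarrow> 'a) set"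
  where "Lat \<A> = {L \<in> projections. \<forall>A\<in>\<A>. proj_compl L \<circ> A \<circ> L = (\<lambda>x. 0)}"

definition Alg :: "('a::separable_hilbert \<Rightarrow> 'a) set \<Rightarrow> ('a \<Rightarrow> 'a) set"
  where "Alg \<L> = {A \<in> bounded_ops. \<forall>L\<in>\<L>. proj_compl L \<circ> A \<circ> L = (\<lambda>x. 0)}"

text \<open>That such a set is a unital algebra is automatic, as every \<open>Alg \<L>\<close> is one.\<close>

definition reflexive_algebra :: "('a::separable_hilbert \<Rightarrow> 'a) set \<Rightarrow> bool"
  where "reflexive_algebra \<A> \<longleftrightarrow> \<A> \<subseteq> bounded_ops \<and> \<A> = Alg (Lat \<A>)"

definition normalizers ::
    "('b::separable_hilbert \<Rightarrow> 'b) set \<Rightarrow> ('a::separable_hilbert \<Rightarrow> 'a) set \<Rightarrow> ('a \<Rightarrow> 'b) set"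
  where "normalizers \<B> \<A> = {T \<in> bounded_ops.
           (\<forall>B\<in>\<B>. cadjoint T \<circ> B \<circ> T \<in> \<A>) \<and> (\<forall>A\<in>\<A>. T \<circ> A \<circ> cadjoint T \<in> \<B>)}"


section \<open>Sup-preserving maps between projection lattices\<close>

text \<open>Only the values of \<open>\<phi>\<close> on projections are meaningful.\<close>

definition sup_maps ::
    "(('a::separable_hilbert \<Rightarrow> 'a) \<Rightarrow> ('b::separable_hilbert \<Rightarrow> 'b)) set"
  where "sup_maps = {\<phi>. \<phi> \<in> projections \<rightarrow> projections \<and> \<phi> (\<lambda>x. 0) = (\<lambda>x. 0) \<and>
           (\<forall>F\<subseteq>projections. \<phi> (proj_Sup F) = proj_Sup (\<phi> ` F))}"

definition S1 :: "(('a::separable_hilbert \<Rightarrow> 'a) \<Rightarrow> ('b::separable_hilbert \<Rightarrow> 'b)) \<Rightarrow> ('a \<Rightarrow> 'a) set"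
  where "S1 \<phi> = {proj_Sup {P \<in> projections. proj_le (\<phi> P) Q} | Q. Q \<in> projections}"

definition S2 :: "(('a::separable_hilbert \<Rightarrow> 'a) \<Rightarrow> ('b::separable_hilbert \<Rightarrow> 'b)) \<Rightarrow> ('b \<Rightarrow> 'b) set"
  where "S2 \<phi> = \<phi> ` projections"

definition sup_maps_between ::
    "('a::separable_hilbert \<Rightarrow> 'a) set \<Rightarrow> ('b::separable_hilbert \<Rightarrow> 'b) set \<Rightarrow> (('a \<Rightarrow> 'a) \<Rightarrow> ('b \<Rightarrow> 'b)) set"
  where "sup_maps_between \<L> \<M> = {\<phi> \<in> sup_maps. S1 \<phi> \<subseteq> \<L> \<and> S2 \<phi> \<subseteq> \<M>}"

text \<open>Used both for \<open>\<U>\<^sub>\<phi>\<close> (with \<open>\<L>\<^sub>1\<close>) and for \<open>\<V>\<^sub>\<psi>\<close> (with \<open>\<L>\<^sub>2\<close>, spaces exchanged).\<close>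

definition intertwiners ::
    "('a::separable_hilbert \<Rightarrow> 'a) set \<Rightarrow> (('a \<Rightarrow> 'a) \<Rightarrow> ('b::separable_hilbert \<Rightarrow> 'b)) \<Rightarrow> ('a \<Rightarrow> 'b) set"
  where "intertwiners \<L> \<phi> = {T \<in> bounded_ops. \<forall>L\<in>\<L>. T \<circ> L = \<phi> L \<circ> T}"


section \<open>Reflexive normalizing subspaces\<close>

definition op_subspace :: "('a::separable_hilbert \<Rightarrow> 'b::separable_hilbert) set \<Rightarrow> bool"
  where "op_subspace \<U> \<longleftrightarrow> \<U> \<subseteq> bounded_ops \<and> (\<lambda>x. 0) \<in> \<U> \<and>
           (\<forall>S\<in>\<U>. \<forall>T\<in>\<U>. (\<lambda>x. S x + T x) \<in> \<U>) \<and> (\<forall>c. \<forall>T\<in>\<U>. (\<lambda>x. c *\<^sub>C T x) \<in> \<U>)"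

definition normalizing_subspace :: "('a::separable_hilbert \<Rightarrow> 'b::separable_hilbert) set \<Rightarrow> bool"
  where "normalizing_subspace \<U> \<longleftrightarrow> op_subspace \<U> \<and>
           (\<forall>A\<in>\<U>. \<forall>B\<in>\<U>. \<forall>C\<in>\<U>. A \<circ> cadjoint B \<circ> C \<in> \<U>)"

definition reflexive_subspace :: "('a::separable_hilbert \<Rightarrow> 'b::separable_hilbert) set \<Rightarrow> bool"
  where "reflexive_subspace \<U> \<longleftrightarrow> op_subspace \<U> \<and>
           (\<forall>T\<in>bounded_ops. (\<forall>x. T x \<in> closure ((\<lambda>S. S x) ` \<U>)) \<longrightarrow> T \<in> \<U>)"

end

theory Submission
  imports Defs
begin

text \<open>For projections, \<open>TL = QT\<close> says that \<open>T\<close> maps the range of \<open>L\<close> into that of \<open>Q\<close> and the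
  orthogonal complement of the first into the complement of the second; equivalently, that
  \<open>T\<^sup>*Q = LT\<^sup>*\<close>.

  Let \<open>T\<close> be a normalizer.  For a projection \<open>P\<close> let \<open>\<phi>(P)\<close> be the projection onto the closed
  linear span of all \<open>BTAx\<close> with \<open>B \<in> \<B>\<close>, \<open>A \<in> \<A>\<close> and \<open>x\<close> in the range of \<open>P\<close>.  Then
  \<open>\<phi>(P) \<le> Q\<close> holds exactly if \<open>P\<close> lies below the projection onto the space of those \<open>x\<close> for which
  every \<open>BTAx\<close> is in the range of \<open>Q\<close>.  So \<open>\<phi>\<close> is a left Galois adjoint: it preserves suprema, and
  the projections that make up \<open>S1 \<phi>\<close> are the values of the right adjoint.  The factor \<open>B\<close> makes
  the values of \<open>\<phi>\<close> invariant under \<open>\<B>\<close>, the factor \<open>A\<close> makes those of the right adjoint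
  invariant under \<open>\<A>\<close>; this is \<open>bimodule_map_sup_maps_between\<close>.
  That \<open>T\<close> intertwines every invariant \<open>L\<close> with \<open>\<phi>(L)\<close> is where the normalizer condition enters:
  \<open>T\<close> maps \<open>L\<close> into \<open>\<phi>(L)\<close> as both algebras contain the identity, and for \<open>x\<close> in the range of \<open>L\<close>
  and \<open>z\<close> orthogonal to it, \<open>\<langle>BTAx, Tz\<rangle> = \<langle>(T\<^sup>*BT)Ax, z\<rangle> = 0\<close> because \<open>T\<^sup>*BT \<in> \<A>\<close> keeps
  the range of \<open>L\<close> invariant (\<open>bimodule_map_intertwines\<close>).  The adjoint \<open>T\<^sup>*\<close> normalizes \<open>\<A>\<close>
  into \<open>\<B>\<close>, so the same construction with the spaces exchanged yields \<open>\<psi>\<close>.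

  Conversely, if \<open>T\<close> intertwines each \<open>L\<close> with an invariant \<open>\<phi>(L)\<close>, then \<open>T\<close> takes the range of
  \<open>L\<close> to that of \<open>\<phi>(L)\<close>, \<open>B\<close> keeps the latter invariant, and \<open>T\<^sup>*\<close> takes it back to that of \<open>L\<close>.
  Thus \<open>T\<^sup>*BT\<close> leaves every member of \<open>Lat \<A>\<close> invariant and reflexivity puts it in \<open>\<A>\<close>
  (\<open>intertwiner_conjugates\<close>).  Finally, an intersection \<open>\<U>\<^sub>\<phi> \<inter> \<V>\<^sub>\<psi>\<^sup>*\<close> is cut out by
  intertwining relations between projections, and such relations pass to \<open>AB\<^sup>*C\<close>, because
  \<open>B\<^sup>*\<close> intertwines in the opposite direction, and to pointwise limits.\<close>

section \<open>Complex scalars and the real inner product\<close>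

lemma cinner_scaleC_right:
  fixes x y :: "'a::complex_inner"
  shows "cinner x (c *\<^sub>C y) = cnj c * cinner x y"
  by (metis cinner_commute cinner_scaleC_left complex_cnj_mult)

lemma inner_scaleC_left:
  fixes x y :: "'a::complex_inner"
  shows "inner (c *\<^sub>C x) y = inner x (cnj c *\<^sub>C y)"
  by (simp flip: Re_cinner add: cinner_scaleC_left cinner_scaleC_right)

lemma scaleC_zero_right [simp]:
  fixes c :: complex
  shows "c *\<^sub>C (0::'a::complex_inner) = 0"
  using scaleC_add_right[of c "0::'a" 0] by simp

lemma scaleC_diff_right:
  fixes x y :: "'a::complex_inner"
  shows "c *\<^sub>C (x - y) = c *\<^sub>C x - c *\<^sub>C y"
  using scaleC_add_right[of c "x - y" y] by (simp add: algebra_simps)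

lemma norm_scaleC:
  fixes x :: "'a::complex_inner"
  shows "norm (c *\<^sub>C x) = cmod c * norm x"
proof -
  have "inner (c *\<^sub>C x) (c *\<^sub>C x) = inner x ((cnj c * c) *\<^sub>C x)"
    by (simp add: inner_scaleC_left scaleC_scaleC)
  also have "cnj c * c = complex_of_real ((cmod c)\<^sup>2)"
    by (metis complex_norm_square mult.commute)
  also have "inner x (complex_of_real ((cmod c)\<^sup>2) *\<^sub>C x) = (cmod c * norm x)\<^sup>2"
    by (simp only: scaleC_of_real inner_scaleR_right dot_square_norm power_mult_distrib)
  finally have "(norm (c *\<^sub>C x))\<^sup>2 = (cmod c * norm x)\<^sup>2"
    by (simp add: dot_square_norm)
  then show ?thesis by simp
qed

lemma bounded_linear_scaleC:
  "bounded_linear (\<lambda>x::'a::complex_inner. c *\<^sub>C x)"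
proof (rule bounded_linear_intro[where K = "cmod c"])
  fix r and x :: 'a
  show "c *\<^sub>C r *\<^sub>R x = r *\<^sub>R c *\<^sub>C x"
    by (simp flip: scaleC_of_real add: scaleC_scaleC mult.commute)
qed (simp_all add: scaleC_add_right norm_scaleC mult.commute)


section \<open>Orthogonal decomposition and adjoints\<close>

lemma parallelogram_midpoint:
  fixes x a b :: "'a::real_inner"
  shows "(norm (a - b))\<^sup>2 = 2 * (norm (x - a))\<^sup>2 + 2 * (norm (x - b))\<^sup>2
           - 4 * (norm (x - (1/2) *\<^sub>R (a + b)))\<^sup>2"
  by (simp add: power2_norm_eq_inner inner_commute algebra_simps)

lemma minimizer_orthogonal:
  fixes u s :: "'a::real_inner"
  assumes "\<And>t. (norm u)\<^sup>2 \<le> (norm (u - t *\<^sub>R s))\<^sup>2"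
  shows "inner u s = 0"
proof (cases "s = 0")
  case False
  define t where "t = inner u s / inner s s"
  have "(norm (u - t *\<^sub>R s))\<^sup>2 = (norm u)\<^sup>2 - 2 * t * inner u s + t * (t * inner s s)"
    by (simp add: power2_norm_eq_inner inner_commute algebra_simps)
  also have "t * inner s s = inner u s" using False by (simp add: t_def)
  finally have "t * inner u s \<le> 0" using assms[of t] by linarith
  then have "(inner u s)\<^sup>2 \<le> 0 * inner s s"
    using False by (simp add: t_def power2_eq_square divide_simps split: if_splits)
  then show ?thesis by simp
qed simp

text \<open>Balls need not be compact in infinite dimension.  Instead the parallelogram law makes a sequence
  that minimizes the distance from \<open>x\<close> to \<open>S\<close> Cauchy, since all midpoints stay in \<open>S\<close>.\<close>

lemma orthogonal_decomposition:
  fixes S :: "'a::{real_inner,complete_space} set"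
  assumes "subspace S" "closed S"
  obtains p where "p \<in> S" "\<And>s. s \<in> S \<Longrightarrow> inner (x - p) s = 0"
proof -
  define D where "D = (\<lambda>s. (norm (x - s))\<^sup>2) ` S"
  define d where "d = Inf D"
  have "0 \<in> S" using assms(1) by (rule subspace_0)
  then have ne: "D \<noteq> {}" by (auto simp: D_def)
  have bdd: "bdd_below D" by (auto simp: D_def intro!: bdd_belowI[of _ 0])
  have low: "d \<le> (norm (x - s))\<^sup>2" if "s \<in> S" for s
    unfolding d_def using bdd that by (intro cInf_lower) (auto simp: D_def)
  have "\<exists>s\<in>S. (norm (x - s))\<^sup>2 < d + inverse (Suc n)" for n
    using cInf_lessD[OF ne, of "d + inverse (Suc n)"] by (auto simp: D_def d_def)
  then obtain f where f: "\<And>n. f n \<in> S" "\<And>n. (norm (x - f n))\<^sup>2 < d + inverse (Suc n)"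
    by metis
  have gap: "(norm (f m - f n))\<^sup>2 \<le> 2 * inverse (Suc m) + 2 * inverse (Suc n)" for m n
  proof -
    have "(1/2) *\<^sub>R (f m + f n) \<in> S"
      using assms(1) f(1) by (intro subspace_scale subspace_add)
    from low[OF this] show ?thesis
      using f(2)[of m] f(2)[of n] parallelogram_midpoint[of "f m" "f n" x] by linarith
  qed
  have "Cauchy f"
  proof (rule CauchyI)
    fix e :: real assume "0 < e"
    then obtain N where N: "inverse (Suc N) < e\<^sup>2 / 4"
      using reals_Archimedean[of "e\<^sup>2 / 4"] by auto
    have "norm (f m - f n) < e" if "m \<ge> N" "n \<ge> N" for m n
    proof -
      have "inverse (Suc m) \<le> inverse (real (Suc N))" "inverse (Suc n) \<le> inverse (real (Suc N))"
        using that by (auto intro!: le_imp_inverse_le)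
      then have "(norm (f m - f n))\<^sup>2 < e\<^sup>2" using gap[of m n] N by linarith
      then show ?thesis using \<open>0 < e\<close> by (simp add: power_less_imp_less_base)
    qed
    then show "\<exists>M. \<forall>m\<ge>M. \<forall>n\<ge>M. norm (f m - f n) < e" by blast
  qed
  then obtain p where p: "f \<longlonglongrightarrow> p"
    using Cauchy_convergent convergent_def by blast
  have pS: "p \<in> S" using closed_sequentially[OF assms(2)] f(1) p by blast
  have "(norm (x - p))\<^sup>2 \<le> d + 0"
  proof (rule LIMSEQ_le)
    show "(\<lambda>n. (norm (x - f n))\<^sup>2) \<longlonglongrightarrow> (norm (x - p))\<^sup>2"
      by (intro tendsto_intros p)
    show "(\<lambda>n. d + inverse (real (Suc n))) \<longlonglongrightarrow> d + 0"
      by (intro tendsto_intros LIMSEQ_inverse_real_of_nat)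
  qed (use f(2) less_imp_le in blast)
  then have min: "(norm (x - p))\<^sup>2 \<le> (norm (x - s))\<^sup>2" if "s \<in> S" for s
    using low[OF that] by linarith
  have "inner (x - p) s = 0" if "s \<in> S" for s
  proof (rule minimizer_orthogonal)
    fix t
    have "p + t *\<^sub>R s \<in> S" using assms(1) pS that by (intro subspace_add subspace_scale)
    from min[OF this] show "(norm (x - p))\<^sup>2 \<le> (norm (x - p - t *\<^sub>R s))\<^sup>2"
      by (simp add: diff_diff_eq)
  qed
  with pS show thesis by (rule that)
qed

text \<open>Riesz representation: a vector orthogonal to the kernel of a functional represents it, up to
  rescaling.\<close>

lemma riesz_representation:
  fixes f :: "'a::{real_inner,complete_space} \<Rightarrow> real"
  assumes "bounded_linear f"
  shows "\<exists>v. \<forall>x. f x = inner x v"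
proof (cases "\<forall>x. f x = 0")
  case True
  then show ?thesis by (intro exI[of _ 0]) simp
next
  case False
  then obtain z where z: "f z \<noteq> 0" by blast
  interpret f: bounded_linear f by fact
  define K where "K = {x. f x = 0}"
  have "subspace K" by (auto simp: K_def subspace_def f.add f.scaleR f.zero)
  moreover have "closed K" unfolding K_def
    by (intro closed_Collect_eq continuous_on_const linear_continuous_on assms)
  ultimately obtain p where p: "p \<in> K" "\<And>s. s \<in> K \<Longrightarrow> inner (z - p) s = 0"
    using orthogonal_decomposition by blast
  define u where "u = z - p"
  have fu: "f u \<noteq> 0" using z p(1) by (simp add: u_def f.diff K_def)
  then have "u \<noteq> 0" using f.zero by auto
  have "f x = inner x ((f u / inner u u) *\<^sub>R u)" for x
  proof -
    have "x - (f x / f u) *\<^sub>R u \<in> K" using fu by (simp add: K_def f.diff f.scaleR)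
    from p(2)[OF this] have "inner x u = f x / f u * inner u u"
      by (simp add: inner_diff_right flip: u_def) (simp add: inner_commute)
    then show ?thesis using fu \<open>u \<noteq> 0\<close> by simp
  qed
  then show ?thesis by blast
qed

lemma bounded_opsD:
  assumes "T \<in> bounded_ops"
  shows "bounded_linear T" "T (c *\<^sub>C x) = c *\<^sub>C T x"
    and "T (x + y) = T x + T y" "T (x - y) = T x - T y" "T 0 = 0" "continuous_on U T"
proof -
  show bl: "bounded_linear T" and "T (c *\<^sub>C x) = c *\<^sub>C T x"
    using assms by (auto simp: bounded_ops_def)
  interpret bounded_linear T by fact
  show "T (x + y) = T x + T y" "T (x - y) = T x - T y" "T 0 = 0"
    by (rule add diff zero)+
  show "continuous_on U T" by (rule linear_continuous_on) fact
qed

lemma bounded_ops_comp: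
  assumes "S \<in> bounded_ops" "T \<in> bounded_ops"
  shows "S \<circ> T \<in> bounded_ops"
  using assms by (auto simp: bounded_ops_def o_def intro: bounded_linear_compose)

lemma bounded_ops_add:
  assumes "S \<in> bounded_ops" "T \<in> bounded_ops"
  shows "(\<lambda>x. S x + T x) \<in> bounded_ops"
  using assms by (auto simp: bounded_ops_def scaleC_add_right intro: bounded_linear_add)

lemma bounded_ops_scaleC:
  assumes "T \<in> bounded_ops"
  shows "(\<lambda>x. c *\<^sub>C T x) \<in> bounded_ops"
  using assms bounded_linear_compose[OF bounded_linear_scaleC]
  by (auto simp: bounded_ops_def scaleC_scaleC mult.commute)

lemma bounded_ops_zero: "(\<lambda>x. 0) \<in> bounded_ops"
  by (simp add: bounded_ops_def)

lemma eq_if_inner_eq: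
  assumes "\<And>x::'a::real_inner. inner x a = inner x b"
  shows "a = b"
  using assms[of "a - b"] by (metis eq_iff_diff_eq_0 inner_diff_right inner_eq_zero_iff)

lemma ex_adjoint:
  fixes T :: "'a::separable_hilbert \<Rightarrow> 'b::separable_hilbert"
  assumes T: "T \<in> bounded_ops"
  shows "\<exists>S\<in>bounded_ops. \<forall>x y. inner (T x) y = inner x (S y)"
proof -
  interpret T: bounded_linear T by (rule bounded_opsD[OF T])
  have "\<exists>v. \<forall>x. inner (T x) y = inner x v" for y
    by (rule riesz_representation)
      (intro bounded_linear_compose[OF bounded_linear_inner_left T.bounded_linear_axioms])
  then obtain S where S: "\<And>x y. inner (T x) y = inner x (S y)" by metis
  obtain K where K: "\<And>x. norm (T x) \<le> norm x * K" and "0 \<le> K"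
    using T.nonneg_bounded by blast
  have "bounded_linear S"
  proof (rule bounded_linear_intro[where K = K])
    fix x y :: 'b and r :: real
    show "S (x + y) = S x + S y"
      by (rule eq_if_inner_eq) (simp add: inner_add_right flip: S)
    show "S (r *\<^sub>R x) = r *\<^sub>R S x"
      by (rule eq_if_inner_eq) (simp flip: S)
    have "norm (S x) * norm (S x) = inner (T (S x)) x"
      by (simp add: S dot_square_norm power2_eq_square)
    also have "\<dots> \<le> norm (S x) * K * norm x"
      by (rule order_trans[OF norm_cauchy_schwarz mult_right_mono[OF K norm_ge_zero]])
    finally show "norm (S x) \<le> norm x * K"
      using \<open>0 \<le> K\<close> by (cases "norm (S x) = 0") (auto simp: mult.commute mult.left_commute)
  qed
  moreover have "S (c *\<^sub>C y) = c *\<^sub>C S y" for c y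
  proof (rule eq_if_inner_eq)
    fix x
    have "inner x (S (c *\<^sub>C y)) = inner (cnj c *\<^sub>C T x) y" by (simp add: inner_scaleC_left flip: S)
    also have "\<dots> = inner (T (cnj c *\<^sub>C x)) y" by (simp add: bounded_opsD[OF T])
    also have "\<dots> = inner x (c *\<^sub>C S y)" by (simp add: S inner_scaleC_left)
    finally show "inner x (S (c *\<^sub>C y)) = inner x (c *\<^sub>C S y)" .
  qed
  ultimately show ?thesis using S by (auto simp: bounded_ops_def)
qed

text \<open>The imaginary part of the form at \<open>x\<close> is, up to sign, its real part at \<open>\<i>x\<close>, and \<open>T\<close> commutes
  with \<open>\<i>\<close>.  Hence orthogonality arguments can be carried out with the real inner product alone.\<close>

lemma adjoint_form_iff:
  fixes T :: "'a::separable_hilbert \<Rightarrow> 'b::separable_hilbert"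
  assumes T: "T \<in> bounded_ops"
  shows "(\<forall>x y. cinner (T x) y = cinner x (S y)) \<longleftrightarrow> (\<forall>x y. inner (T x) y = inner x (S y))"
proof
  assume R: "\<forall>x y. inner (T x) y = inner x (S y)"
  have im: "Im (cinner x y) = - inner (\<i> *\<^sub>C x) y" for x y :: "'c::complex_inner"
    by (simp add: cinner_scaleC_left flip: Re_cinner)
  show "\<forall>x y. cinner (T x) y = cinner x (S y)"
    using R by (simp add: complex_eq_iff Re_cinner im flip: bounded_opsD(2)[OF T])
qed (metis Re_cinner)

lemma cadjoint_eqI:
  assumes "T \<in> bounded_ops" "S \<in> bounded_ops" "\<And>x y. inner (T x) y = inner x (S y)"
  shows "cadjoint T = S"
  unfolding cadjoint_def adjoint_form_iff[OF assms(1)]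
proof (rule the_equality)
  fix S' assume S': "S' \<in> bounded_ops \<and> (\<forall>x y. inner (T x) y = inner x (S' y))"
  show "S' = S"
    by (rule ext, rule eq_if_inner_eq) (use S' assms(3) in metis)
qed (use assms in blast)

lemma cadjoint:
  assumes "T \<in> bounded_ops"
  shows "cadjoint T \<in> bounded_ops" "inner (T x) y = inner x (cadjoint T y)"
  using ex_adjoint[OF assms] cadjoint_eqI[OF assms] by metis+

lemma cadjoint_cadjoint:
  assumes "T \<in> bounded_ops"
  shows "cadjoint (cadjoint T) = T"
  by (rule cadjoint_eqI) (use cadjoint[OF assms] assms in \<open>auto simp: inner_commute\<close>)

lemma cadjoint_comp:
  assumes "S \<in> bounded_ops" "T \<in> bounded_ops"
  shows "cadjoint (S \<circ> T) = cadjoint T \<circ> cadjoint S"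
  by (rule cadjoint_eqI) (use assms in \<open>auto simp: cadjoint bounded_ops_comp\<close>)


section \<open>Projections and closed subspaces\<close>

definition closed_csubspace :: "'a::complex_inner set \<Rightarrow> bool"
  where "closed_csubspace S \<longleftrightarrow> subspace S \<and> closed S \<and> (\<forall>c. \<forall>x\<in>S. c *\<^sub>C x \<in> S)"

lemma closed_csubspace_Inter:
  "(\<And>S. S \<in> F \<Longrightarrow> closed_csubspace S) \<Longrightarrow> closed_csubspace (\<Inter>F)"
  by (auto simp: closed_csubspace_def intro: subspace_Inter closed_Inter)

text \<open>The closed linear span is rendered as a hull, so that all claims about it reduce to
  \<open>hull_minimal\<close>: it lies in any closed subspace that contains the generators.\<close>

lemma closed_csubspace_hull: "closed_csubspace (closed_csubspace hull X)"
  by (rule hull_in) (simp add: closed_csubspace_Inter)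

lemma closed_csubspace_vimage:
  assumes T: "T \<in> bounded_ops" and S: "closed_csubspace S"
  shows "closed_csubspace {x. T x \<in> S}"
proof -
  interpret T: bounded_linear T by (rule bounded_opsD[OF T])
  have "closed (T -` S)"
    using S by (intro closed_vimage) (auto simp: closed_csubspace_def bounded_opsD[OF T])
  then show ?thesis using S
    by (auto simp: closed_csubspace_def subspace_def vimage_def bounded_opsD(2)[OF T]
        T.add T.scaleR T.zero)
qed

lemma projectionsD:
  assumes "P \<in> projections"
  shows "P \<in> bounded_ops" "P (P x) = P x" "cadjoint P = P" "inner (P x) y = inner x (P y)"
  using assms cadjoint(2)[of P x y] by (auto simp: projections_def fun_eq_iff)

lemma in_range_projection_iff:
  assumes "P \<in> projections"
  shows "x \<in> range P \<longleftrightarrow> P x = x"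
  using projectionsD(2)[OF assms] by (metis rangeE rangeI)

lemma closed_csubspace_range:
  assumes P: "P \<in> projections"
  shows "closed_csubspace (range P)"
proof -
  have b: "P \<in> bounded_ops" using projectionsD[OF P] by blast
  interpret P: bounded_linear P by (rule bounded_opsD[OF b])
  have "range P = {x. P x = x}" using in_range_projection_iff[OF P] by blast
  moreover have "closed {x. P x = x}"
    by (intro closed_Collect_eq continuous_on_id bounded_opsD[OF b])
  ultimately show ?thesis
    by (auto simp: closed_csubspace_def subspace_def bounded_opsD(2)[OF b] P.add P.scaleR P.zero)
qed

lemma projection_eqI:
  assumes P: "P \<in> projections" and Q: "Q \<in> projections" and eq: "range P = range Q"
  shows "P = Q"
proof
  fix x
  have PQ: "P (Q y) = Q y" "Q (P y) = P y" for y
    using eq in_range_projection_iff[OF P] in_range_projection_iff[OF Q] by auto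
  show "P x = Q x"
    by (rule eq_if_inner_eq) (metis PQ projectionsD(4)[OF P] projectionsD(4)[OF Q])
qed

text \<open>The point of \<open>S\<close> with residual orthogonal to \<open>S\<close> is unique, and this alone forces the
  assignment of that point to be linear, idempotent and self-adjoint.\<close>

lemma ex_projection_onto:
  fixes S :: "'a::separable_hilbert set"
  assumes S: "closed_csubspace S"
  shows "\<exists>P\<in>projections. range P = S"
proof -
  have sub: "subspace S" and "closed S" and c: "\<And>c x. x \<in> S \<Longrightarrow> c *\<^sub>C x \<in> S"
    using S by (auto simp: closed_csubspace_def)
  then have "\<exists>p\<in>S. \<forall>s\<in>S. inner (x - p) s = 0" for x
    using orthogonal_decomposition by metis
  then obtain P where P: "\<And>x. P x \<in> S" "\<And>x s. s \<in> S \<Longrightarrow> inner (x - P x) s = 0"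
    by metis
  have uniq: "P x = p" if "p \<in> S" "\<And>s. s \<in> S \<Longrightarrow> inner (x - p) s = 0" for x p
  proof -
    have m: "p - P x \<in> S" using sub that(1) P(1) by (rule subspace_diff)
    have "inner (p - P x) (p - P x) = inner (x - P x) (p - P x) - inner (x - p) (p - P x)"
      by (simp add: inner_diff_left)
    then show ?thesis using P(2)[OF m] that(2)[OF m] by simp
  qed
  have self: "inner (P x) y = inner (P x) (P y)" for x y
    using P(2)[OF P(1), of y x] by (simp add: inner_diff_right inner_diff_left inner_commute[of _ "P x"])
  have "bounded_linear P"
  proof (rule bounded_linear_intro[where K = 1])
    fix x y r
    show "P (x + y) = P x + P y"
      by (rule uniq) (use sub P in \<open>auto simp: subspace_add add_diff_add inner_add_left\<close>)
    show "P (r *\<^sub>R x) = r *\<^sub>R P x"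
      by (rule uniq) (use sub P in \<open>auto simp: subspace_scale inner_scaleR_left
          simp flip: scaleR_diff_right\<close>)
    have "norm (P x) * norm (P x) = inner (P x) x"
      by (simp add: self dot_square_norm power2_eq_square)
    also have "\<dots> \<le> norm (P x) * norm x" by (rule norm_cauchy_schwarz)
    finally show "norm (P x) \<le> norm x * 1" by (cases "norm (P x) = 0") auto
  qed
  moreover have "P (c *\<^sub>C x) = c *\<^sub>C P x" for c x
    by (rule uniq) (use c P in \<open>auto simp: inner_scaleC_left simp flip: scaleC_diff_right\<close>)
  ultimately have bo: "P \<in> bounded_ops" by (simp add: bounded_ops_def)
  have fixS: "P s = s" if "s \<in> S" for s by (rule uniq) (use that in auto)
  have "cadjoint P = P"
    by (rule cadjoint_eqI[OF bo bo]) (metis self inner_commute)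
  then have "P \<in> projections" using bo fixS P(1) by (auto simp: projections_def)
  moreover have "range P = S" using fixS P(1) by (metis image_subset_iff rangeI subsetI subset_antisym)
  ultimately show ?thesis by blast
qed

definition projection_onto :: "'a::separable_hilbert set \<Rightarrow> 'a \<Rightarrow> 'a"
  where "projection_onto S = (SOME P. P \<in> projections \<and> range P = S)"

lemma projection_onto:
  assumes "closed_csubspace S"
  shows "projection_onto S \<in> projections" "range (projection_onto S) = S"
  using someI_ex[of "\<lambda>P. P \<in> projections \<and> range P = S"] ex_projection_onto[OF assms]
  by (auto simp: projection_onto_def)

lemma proj_le_antisym:
  assumes "P \<in> projections" "Q \<in> projections" "proj_le P Q" "proj_le Q P"
  shows "P = Q"
  using assms by (auto simp: proj_le_def intro: projection_eqI)

lemma proj_Sup_eqI: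
  assumes "S \<in> projections" "\<And>P. P \<in> F \<Longrightarrow> proj_le P S"
    and "\<And>Q. Q \<in> projections \<Longrightarrow> (\<And>P. P \<in> F \<Longrightarrow> proj_le P Q) \<Longrightarrow> proj_le S Q"
  shows "proj_Sup F = S"
  unfolding proj_Sup_def
  by (rule the_equality) (use assms in \<open>auto intro!: proj_le_antisym\<close>)

lemma proj_Sup:
  shows "proj_Sup F \<in> projections"
    and "Q \<in> projections \<Longrightarrow> proj_le (proj_Sup F) Q \<longleftrightarrow> (\<forall>P\<in>F. proj_le P Q)"
proof -
  define X where "X = (\<Union>P\<in>F. range P)"
  define S where "S = projection_onto (closed_csubspace hull X)"
  have S: "S \<in> projections" and rS: "range S = closed_csubspace hull X"
    unfolding S_def by (rule projection_onto closed_csubspace_hull)+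
  have upper: "proj_le P S" if "P \<in> F" for P
    using that hull_subset[of X closed_csubspace] by (auto simp: proj_le_def rS X_def)
  have least: "proj_le S Q" if "Q \<in> projections" "\<And>P. P \<in> F \<Longrightarrow> proj_le P Q" for Q
    unfolding proj_le_def rS
    by (rule hull_minimal) (use that in \<open>auto simp: X_def proj_le_def closed_csubspace_range\<close>)
  have eq: "proj_Sup F = S" by (rule proj_Sup_eqI) (use S upper least in auto)
  show "proj_Sup F \<in> projections" by (simp add: eq S)
  show "proj_le (proj_Sup F) Q \<longleftrightarrow> (\<forall>P\<in>F. proj_le P Q)" if "Q \<in> projections"
    using upper least[OF that] unfolding eq proj_le_def by blast
qed

lemma zero_projection: "(\<lambda>x::'a::separable_hilbert. 0) \<in> projections"
  by (auto simp: projections_def bounded_ops_zero intro: cadjoint_eqI)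

text \<open>A left adjoint preserves suprema, and the suprema that make up \<open>S1\<close> are then the values
  of its right adjoint.\<close>

lemma galois_sup_map:
  fixes \<phi> :: "('a::separable_hilbert \<Rightarrow> 'a) \<Rightarrow> ('b::separable_hilbert \<Rightarrow> 'b)"
  assumes \<phi>: "\<And>P. P \<in> projections \<Longrightarrow> \<phi> P \<in> projections"
    and \<rho>: "\<And>Q. Q \<in> projections \<Longrightarrow> \<rho> Q \<in> projections"
    and adj: "\<And>P Q. P \<in> projections \<Longrightarrow> Q \<in> projections \<Longrightarrow> proj_le (\<phi> P) Q \<longleftrightarrow> proj_le P (\<rho> Q)"
  shows "\<phi> \<in> sup_maps" "S1 \<phi> = \<rho> ` projections"
proof -
  have zero_le: "proj_le (\<lambda>x. 0) Q" if Q: "Q \<in> projections" for Q :: "'c::separable_hilbert \<Rightarrow> 'c"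
    using bounded_opsD(5)[OF projectionsD(1)[OF Q]] by (auto simp: proj_le_def intro: rev_image_eqI)
  have "proj_le (\<phi> (\<lambda>x. 0)) (\<lambda>x. 0)"
    by (simp add: adj zero_projection zero_le \<rho>)
  then have "\<phi> (\<lambda>x. 0) = (\<lambda>x. 0)"
    by (intro proj_le_antisym) (auto simp: \<phi> zero_projection zero_le)
  moreover have "\<phi> (proj_Sup F) = proj_Sup (\<phi> ` F)" if F: "F \<subseteq> projections" for F
  proof -
    have *: "proj_le (\<phi> (proj_Sup F)) Q \<longleftrightarrow> (\<forall>P\<in>F. proj_le (\<phi> P) Q)" if "Q \<in> projections" for Q
      using that F by (simp add: adj proj_Sup \<rho> subset_iff)
    have m: "\<phi> (proj_Sup F) \<in> projections" by (intro \<phi> proj_Sup)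
    show ?thesis
    proof (rule proj_Sup_eqI[symmetric, OF m])
      show "proj_le P (\<phi> (proj_Sup F))" if "P \<in> \<phi> ` F" for P
        using *[OF m] that by (auto simp: proj_le_def)
    qed (use * in auto)
  qed
  ultimately show "\<phi> \<in> sup_maps" using \<phi> by (auto simp: sup_maps_def)
  have "proj_Sup {P \<in> projections. proj_le (\<phi> P) Q} = \<rho> Q" if Q: "Q \<in> projections" for Q
  proof (rule proj_Sup_eqI)
    have "proj_le (\<phi> (\<rho> Q)) Q" by (simp add: adj \<rho> Q) (simp add: proj_le_def)
    then show "proj_le (\<rho> Q) Q'"
      if "\<And>P. P \<in> {P \<in> projections. proj_le (\<phi> P) Q} \<Longrightarrow> proj_le P Q'" for Q'
      using that \<rho>[OF Q] by blast
  qed (use Q in \<open>auto simp: \<rho> adj\<close>)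
  then show "S1 \<phi> = \<rho> ` projections" by (force simp: S1_def)
qed


section \<open>Invariant projections\<close>

lemma compress_zero_iff:
  assumes L: "L \<in> projections"
  shows "proj_compl L \<circ> A \<circ> L = (\<lambda>x. 0) \<longleftrightarrow> (\<forall>x\<in>range L. A x \<in> range L)"
proof -
  have "A (L x) - L (A (L x)) = 0 \<longleftrightarrow> A (L x) \<in> range L" for x
    unfolding in_range_projection_iff[OF L] by auto
  then show ?thesis by (simp add: fun_eq_iff proj_compl_def)
qed

lemma Lat_iff:
  "L \<in> Lat \<A> \<longleftrightarrow> L \<in> projections \<and> (\<forall>A\<in>\<A>. \<forall>x\<in>range L. A x \<in> range L)"
  unfolding Lat_def using compress_zero_iff[of L] by blast

lemma reflexive_algebra_iff_invariant:
  assumes "reflexive_algebra \<A>"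
  shows "A \<in> \<A> \<longleftrightarrow> A \<in> bounded_ops \<and> (\<forall>L\<in>Lat \<A>. \<forall>x\<in>range L. A x \<in> range L)"
proof -
  have "A \<in> \<A> \<longleftrightarrow> A \<in> Alg (Lat \<A>)" using assms by (simp add: reflexive_algebra_def)
  also have "\<dots> \<longleftrightarrow> A \<in> bounded_ops \<and> (\<forall>L\<in>Lat \<A>. \<forall>x\<in>range L. A x \<in> range L)"
    unfolding Alg_def by (auto simp: Lat_def compress_zero_iff)
  finally show ?thesis .
qed

lemma reflexive_algebra_unital:
  assumes "reflexive_algebra \<A>"
  shows "id \<in> \<A>"
  by (auto simp: reflexive_algebra_iff_invariant[OF assms] bounded_ops_def id_def)

lemma reflexive_algebra_comp:
  assumes "reflexive_algebra \<A>" "A \<in> \<A>" "B \<in> \<A>"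
  shows "A \<circ> B \<in> \<A>"
proof -
  have "A (B x) \<in> range L" if L: "L \<in> Lat \<A>" and x: "x \<in> range L" for L x
  proof -
    have "B x \<in> range L"
      using assms(3) L x unfolding reflexive_algebra_iff_invariant[OF assms(1)] by blast
    then show ?thesis
      using assms(2) L unfolding reflexive_algebra_iff_invariant[OF assms(1)] by blast
  qed
  moreover have "A \<circ> B \<in> bounded_ops"
    using assms(2,3) unfolding reflexive_algebra_iff_invariant[OF assms(1)]
    by (intro bounded_ops_comp) blast+
  ultimately show ?thesis
    unfolding reflexive_algebra_iff_invariant[OF assms(1)] comp_apply by blast
qed

lemma inner_range_compl:
  assumes L: "L \<in> projections" and x: "x \<in> range L"
  shows "inner (z - L z) x = 0"
  using x by (simp add: in_range_projection_iff[OF L] inner_diff_left projectionsD(4)[OF L])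


section \<open>The supremum-preserving map generated by an operator\<close>

text \<open>The closed span of what the \<open>\<B>\<close>-\<open>\<A>\<close>-bimodule generated by \<open>T\<close> makes of the range of \<open>P\<close>.
  On a projection invariant under \<open>\<A>\<close> the factor \<open>A\<close> changes nothing as long as the identity is
  in \<open>\<A>\<close>; it matters on the other projections, where \<open>sup_maps_between\<close> also constrains the map.\<close>

definition bimodule_map ::
    "('b::separable_hilbert \<Rightarrow> 'b) set \<Rightarrow> ('a::separable_hilbert \<Rightarrow> 'b) \<Rightarrow> ('a \<Rightarrow> 'a) set
      \<Rightarrow> ('a \<Rightarrow> 'a) \<Rightarrow> ('b \<Rightarrow> 'b)"
  where "bimodule_map \<B> T \<A> P =
    projection_onto (closed_csubspace hull {B (T (A x)) | B A x. B \<in> \<B> \<and> A \<in> \<A> \<and> x \<in> range P})"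

lemma bimodule_map:
  shows "bimodule_map \<B> T \<A> P \<in> projections"
    and "range (bimodule_map \<B> T \<A> P) =
      closed_csubspace hull {B (T (A x)) | B A x. B \<in> \<B> \<and> A \<in> \<A> \<and> x \<in> range P}"
  unfolding bimodule_map_def by (rule projection_onto closed_csubspace_hull)+

text \<open>The right adjoint sends \<open>Q\<close> to the largest subspace that \<open>\<B>T\<A>\<close> maps into the range of \<open>Q\<close>.
  Invariance of its values and of those of the map comes from the two algebras being closed under
  products.\<close>

lemma bimodule_map_sup_maps_between:
  fixes T :: "'a::separable_hilbert \<Rightarrow> 'b::separable_hilbert"
  assumes \<A>: "reflexive_algebra \<A>" and \<B>: "reflexive_algebra \<B>" and T: "T \<in> bounded_ops"
  shows "bimodule_map \<B> T \<A> \<in> sup_maps_between (Lat \<A>) (Lat \<B>)"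
proof -
  define X where "X P = {B (T (A x)) | B A x. B \<in> \<B> \<and> A \<in> \<A> \<and> x \<in> range P}" for P :: "'a \<Rightarrow> 'a"
  have rng: "range (bimodule_map \<B> T \<A> P) = closed_csubspace hull X P" for P
    by (simp add: X_def bimodule_map)
  define R where "R Q = {x. \<forall>B\<in>\<B>. \<forall>A\<in>\<A>. B (T (A x)) \<in> range Q}" for Q :: "'b \<Rightarrow> 'b"
  have ops: "A \<in> \<A> \<Longrightarrow> A \<in> bounded_ops" "B \<in> \<B> \<Longrightarrow> B \<in> bounded_ops" for A B
    using \<A> \<B> by (auto simp: reflexive_algebra_def)
  have R: "closed_csubspace (R Q)" if Q: "Q \<in> projections" for Q
  proof -
    have "R Q = \<Inter>{{x. (B \<circ> T \<circ> A) x \<in> range Q} | B A. B \<in> \<B> \<and> A \<in> \<A>}"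
      by (auto simp: R_def)
    also have "closed_csubspace \<dots>"
    proof (rule closed_csubspace_Inter, clarify)
      fix B A assume "B \<in> \<B>" "A \<in> \<A>"
      then show "closed_csubspace {x. (B \<circ> T \<circ> A) x \<in> range Q}"
        by (intro closed_csubspace_vimage closed_csubspace_range bounded_ops_comp ops T Q)
    qed
    finally show ?thesis .
  qed
  have adj: "proj_le (bimodule_map \<B> T \<A> P) Q \<longleftrightarrow> proj_le P (projection_onto (R Q))"
    if Q: "Q \<in> projections" for P Q
  proof -
    have "proj_le (bimodule_map \<B> T \<A> P) Q \<longleftrightarrow> X P \<subseteq> range Q"
      unfolding proj_le_def rng by (rule subset_hull) (rule closed_csubspace_range[OF Q])
    also have "\<dots> \<longleftrightarrow> proj_le P (projection_onto (R Q))"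
    proof -
      have "{B (T (A x)) | B A x. B \<in> \<B> \<and> A \<in> \<A> \<and> x \<in> V} \<subseteq> U \<longleftrightarrow>
          V \<subseteq> {x. \<forall>B\<in>\<B>. \<forall>A\<in>\<A>. B (T (A x)) \<in> U}" for U V
        by auto
      then show ?thesis
        unfolding proj_le_def projection_onto(2)[OF R[OF Q]] unfolding X_def R_def .
    qed
    finally show ?thesis .
  qed
  have galois: "bimodule_map \<B> T \<A> \<in> sup_maps"
      "S1 (bimodule_map \<B> T \<A>) = (\<lambda>Q. projection_onto (R Q)) ` projections"
    by (rule galois_sup_map; simp add: bimodule_map(1) projection_onto(1) R adj)+
  have "projection_onto (R Q) \<in> Lat \<A>" if Q: "Q \<in> projections" for Q
  proof -
    have "A x \<in> R Q" if A: "A \<in> \<A>" and x: "x \<in> R Q" for A x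
      unfolding R_def
    proof clarify
      fix B A' assume "B \<in> \<B>" "A' \<in> \<A>"
      then have "B (T ((A' \<circ> A) x)) \<in> range Q"
        using x reflexive_algebra_comp[OF \<A> _ A] unfolding R_def by blast
      then show "B (T (A' (A x))) \<in> range Q" by simp
    qed
    then show ?thesis by (auto simp: Lat_iff projection_onto R Q)
  qed
  moreover have "bimodule_map \<B> T \<A> P \<in> Lat \<B>" for P
  proof -
    have "B y \<in> closed_csubspace hull X P"
      if B: "B \<in> \<B>" and y: "y \<in> closed_csubspace hull X P" for B y
    proof -
      have "closed_csubspace hull X P \<subseteq> {y. B y \<in> closed_csubspace hull X P}"
      proof (rule hull_minimal)
        show "X P \<subseteq> {y. B y \<in> closed_csubspace hull X P}"
        proof clarify
          fix y assume "y \<in> X P"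
          then obtain B' A x where *: "y = B' (T (A x))" "B' \<in> \<B>" "A \<in> \<A>" "x \<in> range P"
            by (auto simp: X_def)
          have "B y = (B \<circ> B') (T (A x))" by (simp add: *)
          then have "B y \<in> X P"
            unfolding X_def using * reflexive_algebra_comp[OF \<B> B *(2)] by blast
          then show "B y \<in> closed_csubspace hull X P" by (rule hull_inc)
        qed
      qed (intro closed_csubspace_vimage closed_csubspace_hull ops B)
      then show ?thesis using y by blast
    qed
    then show ?thesis by (auto simp: Lat_iff bimodule_map(1) rng)
  qed
  ultimately show ?thesis
    using galois by (auto simp: sup_maps_between_def S2_def)
qed

text \<open>\<open>T\<^sup>*\<close> sends the generators of \<open>\<phi>(L)\<close>, and therefore its whole range, into the range of \<open>L\<close>;
  so \<open>T\<close> sends vectors orthogonal to \<open>L\<close> to vectors orthogonal to \<open>\<phi>(L)\<close>.\<close>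

lemma bimodule_map_intertwines:
  assumes \<A>: "reflexive_algebra \<A>" and \<B>: "reflexive_algebra \<B>"
    and T: "T \<in> bounded_ops" and TBT: "\<And>B. B \<in> \<B> \<Longrightarrow> cadjoint T \<circ> B \<circ> T \<in> \<A>"
  shows "T \<in> intertwiners (Lat \<A>) (bimodule_map \<B> T \<A>)"
proof -
  have "T (L z) = bimodule_map \<B> T \<A> L (T z)" if L: "L \<in> Lat \<A>" for L z
  proof -
    define Q where "Q = bimodule_map \<B> T \<A> L"
    define X where "X = {B (T (A x)) | B A x. B \<in> \<B> \<and> A \<in> \<A> \<and> x \<in> range L}"
    have Q: "Q \<in> projections" and rQ: "range Q = closed_csubspace hull X"
      by (simp_all add: Q_def X_def bimodule_map)
    have Lp: "L \<in> projections" using L by (simp add: Lat_iff)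
    have inv: "A x \<in> range L" if "A \<in> \<A>" "x \<in> range L" for A x
      using L that by (auto simp: Lat_iff)
    have "X \<subseteq> {y. cadjoint T y \<in> range L}"
    proof clarify
      fix y assume "y \<in> X"
      then obtain B A x where *: "y = B (T (A x))" "B \<in> \<B>" "A \<in> \<A>" "x \<in> range L"
        by (auto simp: X_def)
      have "(cadjoint T \<circ> B \<circ> T) (A x) \<in> range L"
        by (rule inv[OF TBT[OF *(2)] inv[OF *(3,4)]])
      then show "cadjoint T y \<in> range L" unfolding *(1) comp_apply .
    qed
    then have "range Q \<subseteq> {y. cadjoint T y \<in> range L}"
      unfolding rQ
      by (rule hull_minimal) (intro closed_csubspace_vimage closed_csubspace_range cadjoint T Lp)
    then have adj: "cadjoint T (Q y) \<in> range L" for y by blast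
    \<comment> \<open>The component of \<open>z\<close> orthogonal to \<open>L\<close> must be annihilated by \<open>QT\<close>.\<close>
    define w where "w = T (z - L z)"
    have "inner (Q w) (Q w) = inner w (Q w)"
      by (simp add: projectionsD(2,4)[OF Q])
    also have "\<dots> = 0"
      by (simp add: w_def cadjoint(2)[OF T] inner_range_compl[OF Lp adj])
    finally have "Q w = 0" by simp
    then have "Q (T z) = Q (T (L z))"
      by (simp add: w_def bounded_opsD(4)[OF T] bounded_opsD(4)[OF projectionsD(1)[OF Q]])
    also have "T (L z) \<in> range Q"
      unfolding rQ
    proof (rule hull_inc)
      have "T (L z) = id (T (id (L z)))" by simp
      then show "T (L z) \<in> X"
        unfolding X_def using reflexive_algebra_unital[OF \<A>] reflexive_algebra_unital[OF \<B>] by blast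
    qed
    then have "Q (T (L z)) = T (L z)" by (simp only: in_range_projection_iff[OF Q])
    finally show ?thesis by (simp add: Q_def)
  qed
  then show ?thesis using T by (auto simp: intertwiners_def)
qed


section \<open>Intertwining relations\<close>

lemma in_intertwiners_iff:
  "T \<in> intertwiners \<L> \<phi> \<longleftrightarrow> T \<in> bounded_ops \<and> (\<forall>L\<in>\<L>. \<forall>x. T (L x) = \<phi> L (T x))"
  by (auto simp: intertwiners_def fun_eq_iff)

text \<open>Take adjoints of both sides; projections are their own adjoints.\<close>

lemma adjoint_intertwines:
  assumes T: "T \<in> bounded_ops" and P: "P \<in> projections" and Q: "Q \<in> projections"
  shows "(\<forall>x. cadjoint T (P x) = Q (cadjoint T x)) \<longleftrightarrow> (\<forall>x. P (T x) = T (Q x))"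
proof -
  have TP: "P \<circ> T \<in> bounded_ops" "T \<circ> Q \<in> bounded_ops"
    by (intro bounded_ops_comp T projectionsD(1) P Q)+
  have "cadjoint (P \<circ> T) = cadjoint T \<circ> P" "cadjoint (T \<circ> Q) = Q \<circ> cadjoint T"
    using assms by (simp_all add: cadjoint_comp projectionsD)
  then have "cadjoint T \<circ> P = Q \<circ> cadjoint T \<longleftrightarrow> P \<circ> T = T \<circ> Q"
    using cadjoint_cadjoint[OF TP(1)] cadjoint_cadjoint[OF TP(2)] by metis
  then show ?thesis unfolding fun_eq_iff comp_apply .
qed

lemma cadjoint_intertwiners_iff:
  assumes \<L>: "\<L> \<subseteq> projections" and \<psi>: "\<psi> \<in> projections \<rightarrow> projections"
  shows "T \<in> cadjoint ` intertwiners \<L> \<psi> \<longleftrightarrow>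
    T \<in> bounded_ops \<and> (\<forall>M\<in>\<L>. \<forall>x. M (T x) = T (\<psi> M x))"
proof -
  have "T \<in> cadjoint ` intertwiners \<L> \<psi> \<longleftrightarrow> T \<in> bounded_ops \<and> cadjoint T \<in> intertwiners \<L> \<psi>"
  proof
    assume "T \<in> bounded_ops \<and> cadjoint T \<in> intertwiners \<L> \<psi>"
    then show "T \<in> cadjoint ` intertwiners \<L> \<psi>"
      using cadjoint_cadjoint[of T] by (intro image_eqI[of _ _ "cadjoint T"]) auto
  qed (auto simp: intertwiners_def cadjoint_cadjoint cadjoint(1))
  also have "\<dots> \<longleftrightarrow> T \<in> bounded_ops \<and> (\<forall>M\<in>\<L>. \<forall>x. M (T x) = T (\<psi> M x))"
  proof -
    have "(\<forall>x. cadjoint T (M x) = \<psi> M (cadjoint T x)) \<longleftrightarrow> (\<forall>x. M (T x) = T (\<psi> M x))"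
      if "T \<in> bounded_ops" "M \<in> \<L>" for M
      using that \<L> \<psi> by (intro adjoint_intertwines) auto
    then show ?thesis using cadjoint(1) unfolding in_intertwiners_iff by blast
  qed
  finally show ?thesis .
qed

text \<open>Along \<open>T\<close>, \<open>B\<close>, \<open>T\<^sup>*\<close> the range of \<open>L\<close> travels into that of \<open>\<phi>(L)\<close>, stays there, and returns.
  The middle step holds because the values of \<open>\<phi>\<close> are invariant under \<open>\<B>\<close>.\<close>

lemma intertwiner_conjugates:
  assumes \<A>: "reflexive_algebra \<A>" and \<B>: "reflexive_algebra \<B>"
    and \<phi>: "\<phi> \<in> sup_maps_between (Lat \<A>) (Lat \<B>)"
    and T: "T \<in> intertwiners (Lat \<A>) \<phi>" and B: "B \<in> \<B>"
  shows "cadjoint T \<circ> B \<circ> T \<in> \<A>"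
proof -
  have bT: "T \<in> bounded_ops" and TL: "\<And>L x. L \<in> Lat \<A> \<Longrightarrow> T (L x) = \<phi> L (T x)"
    using T by (auto simp: in_intertwiners_iff)
  have bB: "B \<in> bounded_ops" using B \<B> by (auto simp: reflexive_algebra_def)
  have "cadjoint T (B (T x)) \<in> range L" if L: "L \<in> Lat \<A>" and x: "x \<in> range L" for L x
  proof -
    have Lp: "L \<in> projections" using L by (simp add: Lat_iff)
    then have \<phi>L: "\<phi> L \<in> Lat \<B>" using \<phi> by (auto simp: sup_maps_between_def S2_def)
    then have Qp: "\<phi> L \<in> projections" by (simp add: Lat_iff)
    have "T x \<in> range (\<phi> L)"
      using TL[OF L] x by (metis in_range_projection_iff[OF Lp] rangeI)
    then have "B (T x) \<in> range (\<phi> L)" using \<phi>L B by (auto simp: Lat_iff)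
    then have "cadjoint T (B (T x)) = cadjoint T (\<phi> L (B (T x)))"
      by (simp only: in_range_projection_iff[OF Qp])
    also have "\<dots> = L (cadjoint T (B (T x)))"
      using iffD2[OF adjoint_intertwines[OF bT Qp Lp]] TL[OF L] by metis
    finally show ?thesis by (metis rangeI)
  qed
  moreover have "cadjoint T \<circ> B \<circ> T \<in> bounded_ops"
    by (intro bounded_ops_comp cadjoint(1) bT bB)
  ultimately show ?thesis
    unfolding reflexive_algebra_iff_invariant[OF \<A>] comp_apply by blast
qed

lemma in_intertwiners_inter_iff:
  assumes "\<M> \<subseteq> projections" "\<psi> \<in> projections \<rightarrow> projections"
  shows "T \<in> intertwiners \<L> \<phi> \<inter> cadjoint ` intertwiners \<M> \<psi> \<longleftrightarrow>
      T \<in> bounded_ops \<and> (\<forall>L\<in>\<L>. \<forall>x. T (L x) = \<phi> L (T x)) \<and> (\<forall>M\<in>\<M>. \<forall>x. M (T x) = T (\<psi> M x))"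
  unfolding Int_iff cadjoint_intertwiners_iff[OF assms] by (auto simp: in_intertwiners_iff)

text \<open>In \<open>AB\<^sup>*C\<close> the outer factors carry a relation \<open>TP = QT\<close> forward, and \<open>B\<^sup>*\<close> carries it back:
  \<open>AB\<^sup>*CP = AB\<^sup>*QC = APB\<^sup>*C = QAB\<^sup>*C\<close>.\<close>

lemma intertwiners_inter_normalizing:
  assumes \<L>: "\<L> \<subseteq> projections" and \<M>: "\<M> \<subseteq> projections"
    and \<phi>: "\<phi> \<in> projections \<rightarrow> projections" and \<psi>: "\<psi> \<in> projections \<rightarrow> projections"
  shows "normalizing_subspace (intertwiners \<L> \<phi> \<inter> cadjoint ` intertwiners \<M> \<psi>)"
proof -
  define W where "W = intertwiners \<L> \<phi> \<inter> cadjoint ` intertwiners \<M> \<psi>"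
  note W = in_intertwiners_inter_iff[OF \<M> \<psi>, of _ \<L> \<phi>, folded W_def]
  have ops: "\<phi> L \<in> bounded_ops" if "L \<in> \<L>" for L
    using that \<L> \<phi> projectionsD(1) by blast
  have ops': "M \<in> bounded_ops" if "M \<in> \<M>" for M
    using that \<M> projectionsD(1) by blast
  have "(\<lambda>x. S x + T x) \<in> W" if "S \<in> W" "T \<in> W" for S T
    using that by (simp add: W bounded_ops_add bounded_opsD(3)[OF ops] bounded_opsD(3)[OF ops'])
  moreover have "(\<lambda>x. c *\<^sub>C T x) \<in> W" if "T \<in> W" for c T
    using that by (simp add: W bounded_ops_scaleC bounded_opsD(2)[OF ops] bounded_opsD(2)[OF ops'])
  moreover have "(\<lambda>x. 0) \<in> W"
    by (simp add: W bounded_ops_zero bounded_opsD(5)[OF ops] bounded_opsD(5)[OF ops'])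
  moreover have "W \<subseteq> bounded_ops" using W by blast
  ultimately have "op_subspace W" unfolding op_subspace_def by blast
  moreover have "A \<circ> cadjoint B \<circ> C \<in> W" if A: "A \<in> W" and B: "B \<in> W" and C: "C \<in> W" for A B C
  proof -
    have bo: "A \<in> bounded_ops" "B \<in> bounded_ops" "C \<in> bounded_ops"
      using A B C by (auto simp: W)
    have "A (cadjoint B (C (L x))) = \<phi> L (A (cadjoint B (C x)))" if L: "L \<in> \<L>" for L x
    proof -
      have "cadjoint B (\<phi> L y) = L (cadjoint B y)" for y
        using adjoint_intertwines[of B "\<phi> L" L] B L \<L> \<phi> by (auto simp: W)
      then show ?thesis using A C L by (simp add: W)
    qed
    moreover have "M (A (cadjoint B (C x))) = A (cadjoint B (C (\<psi> M x)))" if M: "M \<in> \<M>" for M x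
    proof -
      have "cadjoint B (M y) = \<psi> M (cadjoint B y)" for y
        using adjoint_intertwines[of B M "\<psi> M"] B M \<M> \<psi> by (auto simp: W)
      then show ?thesis using A C M by (simp add: W)
    qed
    ultimately show ?thesis using bo by (simp add: W bounded_ops_comp cadjoint)
  qed
  ultimately show ?thesis by (simp add: normalizing_subspace_def flip: W_def)
qed

text \<open>The relation \<open>TP = QT\<close> as it stands compares values of \<open>T\<close> at two different points, while the
  approximating operators may depend on the point.  It splits into two conditions that each concern
  one value of \<open>T\<close>: the value at \<open>Px\<close> is fixed by \<open>Q\<close>, and the value at \<open>x - Px\<close> is annihilated
  by \<open>Q\<close>.\<close>

lemma intertwines_in_closure:
  fixes P :: "'a::separable_hilbert \<Rightarrow> 'a" and Q :: "'b::separable_hilbert \<Rightarrow> 'b"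
  assumes P: "P \<in> projections" and Q: "Q \<in> projections" and T: "T \<in> bounded_ops"
    and U: "\<And>S. S \<in> U \<Longrightarrow> S \<in> bounded_ops" "\<And>S x. S \<in> U \<Longrightarrow> S (P x) = Q (S x)"
    and cl: "\<And>x. T x \<in> closure ((\<lambda>S. S x) ` U)"
  shows "T (P x) = Q (T x)"
proof -
  have bQ: "Q \<in> bounded_ops" by (rule projectionsD[OF Q])
  have "closure ((\<lambda>S. S (P x)) ` U) \<subseteq> {y. Q y = y}"
    by (rule closure_minimal)
      (auto simp: U projectionsD[OF Q] intro!: closed_Collect_eq bounded_opsD(6)[OF bQ])
  then have "Q (T (P x)) = T (P x)" using cl[of "P x"] by blast
  moreover have "closure ((\<lambda>S. S (x - P x)) ` U) \<subseteq> {y. Q y = 0}"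
  proof (rule closure_minimal)
    show "(\<lambda>S. S (x - P x)) ` U \<subseteq> {y. Q y = 0}"
    proof clarify
      fix S assume S: "S \<in> U"
      have "Q (S (x - P x)) = S (P (x - P x))" using U(2)[OF S] by simp
      also have "P (x - P x) = 0"
        by (simp add: bounded_opsD(4)[OF projectionsD(1)[OF P]] projectionsD(2)[OF P])
      finally show "Q (S (x - P x)) = 0" by (simp add: bounded_opsD(5)[OF U(1)[OF S]])
    qed
  qed (intro closed_Collect_eq bounded_opsD(6)[OF bQ] continuous_on_const)
  then have "Q (T (x - P x)) = 0" using cl[of "x - P x"] by blast
  then have "Q (T x) = Q (T (P x))"
    by (simp add: bounded_opsD(4)[OF T] bounded_opsD(4)[OF bQ])
  ultimately show ?thesis by simp
qed

lemma intertwiners_inter_reflexive: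
  assumes \<L>: "\<L> \<subseteq> projections" and \<M>: "\<M> \<subseteq> projections"
    and \<phi>: "\<phi> \<in> projections \<rightarrow> projections" and \<psi>: "\<psi> \<in> projections \<rightarrow> projections"
  shows "reflexive_subspace (intertwiners \<L> \<phi> \<inter> cadjoint ` intertwiners \<M> \<psi>)"
    (is "reflexive_subspace ?W")
proof -
  note W = in_intertwiners_inter_iff[OF \<M> \<psi>, of _ \<L> \<phi>]
  have "T \<in> ?W" if T: "T \<in> bounded_ops" and cl: "\<And>x. T x \<in> closure ((\<lambda>S. S x) ` ?W)" for T
  proof -
    have "T (L x) = \<phi> L (T x)" if L: "L \<in> \<L>" for L x
    proof (rule intertwines_in_closure[OF _ _ T _ _ cl])
      show "S \<in> bounded_ops" "S (L x) = \<phi> L (S x)" if "S \<in> ?W" for S x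
        using that L unfolding W by blast+
    qed (use L \<L> \<phi> in auto)
    moreover have "T (\<psi> M x) = M (T x)" if M: "M \<in> \<M>" for M x
    proof (rule intertwines_in_closure[OF _ _ T _ _ cl])
      show "S \<in> bounded_ops" "S (\<psi> M x) = M (S x)" if "S \<in> ?W" for S x
        using that M unfolding W by auto
    qed (use M \<M> \<psi> in auto)
    ultimately show ?thesis using T unfolding W by metis
  qed
  moreover have "op_subspace ?W"
    using intertwiners_inter_normalizing[OF assms] by (simp add: normalizing_subspace_def)
  ultimately show ?thesis by (auto simp: reflexive_subspace_def)
qed

theorem corollary5p3:
  fixes \<A> :: "('a::separable_hilbert \<Rightarrow> 'a) set"
    and \<B> :: "('b::separable_hilbert \<Rightarrow> 'b) set"
    and \<L>\<^sub>1 :: "('a \<Rightarrow> 'a) set"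
    and \<L>\<^sub>2 :: "('b \<Rightarrow> 'b) set"
  assumes "reflexive_algebra \<A>" and "reflexive_algebra \<B>"
    and "\<L>\<^sub>1 = Lat \<A>" and "\<L>\<^sub>2 = Lat \<B>"
  shows "(\<exists>\<F>. (\<forall>\<U>\<in>\<F>. normalizing_subspace \<U> \<and> reflexive_subspace \<U>) \<and> normalizers \<B> \<A> = \<Union>\<F>)
    \<and> normalizers \<B> \<A> =
        \<Union>{intertwiners \<L>\<^sub>1 \<phi> \<inter> cadjoint ` intertwiners \<L>\<^sub>2 \<psi> | \<phi> \<psi>.
            \<phi> \<in> sup_maps_between \<L>\<^sub>1 \<L>\<^sub>2 \<and> \<psi> \<in> sup_maps_between \<L>\<^sub>2 \<L>\<^sub>1}
    \<and> (\<forall>\<phi>\<in>sup_maps_between \<L>\<^sub>1 \<L>\<^sub>2. \<forall>\<psi>\<in>sup_maps_between \<L>\<^sub>2 \<L>\<^sub>1.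
          normalizing_subspace (intertwiners \<L>\<^sub>1 \<phi> \<inter> cadjoint ` intertwiners \<L>\<^sub>2 \<psi>) \<and>
          reflexive_subspace (intertwiners \<L>\<^sub>1 \<phi> \<inter> cadjoint ` intertwiners \<L>\<^sub>2 \<psi>))"
proof -
  note \<A> = assms(1) and \<B> = assms(2)
  define \<F> where "\<F> = {intertwiners \<L>\<^sub>1 \<phi> \<inter> cadjoint ` intertwiners \<L>\<^sub>2 \<psi> | \<phi> \<psi>.
            \<phi> \<in> sup_maps_between \<L>\<^sub>1 \<L>\<^sub>2 \<and> \<psi> \<in> sup_maps_between \<L>\<^sub>2 \<L>\<^sub>1}"
  have lat: "\<L>\<^sub>1 \<subseteq> projections" "\<L>\<^sub>2 \<subseteq> projections" by (auto simp: assms Lat_def)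
  have parts: "normalizing_subspace (intertwiners \<L>\<^sub>1 \<phi> \<inter> cadjoint ` intertwiners \<L>\<^sub>2 \<psi>) \<and>
          reflexive_subspace (intertwiners \<L>\<^sub>1 \<phi> \<inter> cadjoint ` intertwiners \<L>\<^sub>2 \<psi>)"
    if "\<phi> \<in> sup_maps_between \<L>\<^sub>1 \<L>\<^sub>2" "\<psi> \<in> sup_maps_between \<L>\<^sub>2 \<L>\<^sub>1" for \<phi> \<psi>
  proof -
    have "\<phi> \<in> projections \<rightarrow> projections" "\<psi> \<in> projections \<rightarrow> projections"
      using that unfolding sup_maps_between_def sup_maps_def by blast+
    with lat show ?thesis by (blast intro: intertwiners_inter_normalizing intertwiners_inter_reflexive)
  qed
  have "normalizers \<B> \<A> = \<Union>\<F>"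
  proof (intro equalityI subsetI)
    fix T assume "T \<in> normalizers \<B> \<A>"
    then have T: "T \<in> bounded_ops" and TBT: "\<And>B. B \<in> \<B> \<Longrightarrow> cadjoint T \<circ> B \<circ> T \<in> \<A>"
      and TAT: "\<And>A. A \<in> \<A> \<Longrightarrow> cadjoint (cadjoint T) \<circ> A \<circ> cadjoint T \<in> \<B>"
      by (auto simp: normalizers_def cadjoint_cadjoint)
    have T': "cadjoint T \<in> bounded_ops" by (rule cadjoint(1)[OF T])
    have "T \<in> intertwiners \<L>\<^sub>1 (bimodule_map \<B> T \<A>)"
      unfolding assms by (rule bimodule_map_intertwines[OF \<A> \<B> T TBT])
    moreover have "cadjoint T \<in> intertwiners \<L>\<^sub>2 (bimodule_map \<A> (cadjoint T) \<B>)"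
      unfolding assms by (rule bimodule_map_intertwines[OF \<B> \<A> T' TAT])
    then have "T \<in> cadjoint ` intertwiners \<L>\<^sub>2 (bimodule_map \<A> (cadjoint T) \<B>)"
      using cadjoint_cadjoint[OF T] by (intro rev_image_eqI) auto
    moreover have "bimodule_map \<B> T \<A> \<in> sup_maps_between \<L>\<^sub>1 \<L>\<^sub>2"
      "bimodule_map \<A> (cadjoint T) \<B> \<in> sup_maps_between \<L>\<^sub>2 \<L>\<^sub>1"
      unfolding assms
      by (rule bimodule_map_sup_maps_between[OF \<A> \<B> T] bimodule_map_sup_maps_between[OF \<B> \<A> T'])+
    ultimately show "T \<in> \<Union>\<F>" unfolding \<F>_def by blast
  next
    fix T assume "T \<in> \<Union>\<F>"
    then obtain \<phi> \<psi> S where \<phi>: "\<phi> \<in> sup_maps_between (Lat \<A>) (Lat \<B>)"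
      and \<psi>: "\<psi> \<in> sup_maps_between (Lat \<B>) (Lat \<A>)"
      and T: "T \<in> intertwiners (Lat \<A>) \<phi>" and S: "S \<in> intertwiners (Lat \<B>) \<psi>" "T = cadjoint S"
      unfolding \<F>_def assms by blast
    have bT: "T \<in> bounded_ops" using T by (simp add: in_intertwiners_iff)
    have "cadjoint T = S" using S by (simp add: in_intertwiners_iff cadjoint_cadjoint)
    then have "T \<circ> A \<circ> cadjoint T \<in> \<A>' \<longleftrightarrow> cadjoint S \<circ> A \<circ> S \<in> \<A>'" for A \<A>' by (simp add: S)
    then show "T \<in> normalizers \<B> \<A>"
      using bT intertwiner_conjugates[OF \<A> \<B> \<phi> T] intertwiner_conjugates[OF \<B> \<A> \<psi> S(1)]
      by (simp add: normalizers_def)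
  qed
  moreover have "\<forall>\<U>\<in>\<F>. normalizing_subspace \<U> \<and> reflexive_subspace \<U>"
    unfolding \<F>_def using parts by blast
  ultimately show ?thesis using parts unfolding \<F>_def by blast
qed

end
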